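(* Let $X, Y, Z$ be abelian groups, let $g: X \to Y$ and $f: Y \to Z$ be arbitrary maps, let $k \geq 1$, $x \in X$, and $u_1, \dots, u_k \in X$. Then $$\Delta(f \circ g;\, x;\, u_1, \dots, u_k) = \sum_{H \in \mathrm{Cov}(k)} \Delta\big(f;\, g(x);\, (\Delta(g;\, x;\, u_T))_{T \in H}\big),$$ where $\mathrm{Cov}(k)$ denotes the set of coverings of $[k]=\{1,\dots,k\}$ by nonempty subsets.
   Context: For a map $h: A \to B$ between abelian groups, $a \in A$ and a finite family of directions $(w_i)_{i\in I}$ in $A$ (directions may coincide), the iterated forward difference is $$\Delta(h; a; (w_i)_{i \in I}) := \sum_{S \subseteq I} (-1)^{|I|-|S|}\, h\big(a + \textstyle\sum_{i \in S} w_i\big) \in B.$$ It does not depend on an ordering of $I$. For $u_1,\dots,u_k\in X$ and $T \subseteq [k]$ write $u_T = (u_i)_{i \in T}$. A covering of $[k]$ by nonempty subsets is a nonempty set $H$ of nonempty subsets of $[k]$ (overlaps allowed) with $\bigcup_{T \in H} T = [k]$. In $(\Delta(g;x;u_T))_{T\in H}$ the family is indexed by the elements $T$ of $H$, so there are $|H|$ directions. *)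

theory Defs
  imports Main
begin

text \<open>
  The family of directions is indexed by a set \<open>I\<close>, so directions may coincide.  The class
  \<^class>\<open>ab_group_add\<close> has no integer scalar multiplication; the sign \<open>(-1)^n\<close> therefore acts by
  the parity of \<open>n\<close>.  Only finite index sets are meaningful.
\<close>

definition iterated_diff ::
  "('a::ab_group_add \<Rightarrow> 'b::ab_group_add) \<Rightarrow> 'a \<Rightarrow> 'i set \<Rightarrow> ('i \<Rightarrow> 'a) \<Rightarrow> 'b"
where
  "iterated_diff h a I w =
     (\<Sum>S\<in>Pow I. if even (card I - card S) then h (a + (\<Sum>i\<in>S. w i))
                  else - h (a + (\<Sum>i\<in>S. w i)))"

definition coverings :: "nat \<Rightarrow> nat set set set" where
  "coverings k = {H. H \<noteq> {} \<and> (\<forall>T\<in>H. T \<noteq> {}) \<and> \<Union>H = {1..k}}"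

end

theory Submission
  imports Defs
begin

text \<open>
  The proof rests on Moebius inversion over the lattice of finite subsets of the index set.
  Iterated differences are characterised by Newton's formula \<open>sum_iterated_diff_subsets\<close>: the
  differences of \<open>h\<close> at \<open>a\<close> over all subfamilies of the directions \<open>w\<close> indexed by \<open>J\<close> add up to
  \<open>h (a + (\<Sum>j\<in>J. w j))\<close>.  Since a set
  function is determined by its sums over lower sets (\<open>subset_sums_determine\<close>), it suffices to
  show that the right-hand side of the chain rule, as a function of the index set \<open>A\<close>, has subset
  sums \<open>f (g (x + (\<Sum>i\<in>A. u i)))\<close>.

  Newton's formula for \<open>g\<close> says that \<open>g (x + (\<Sum>i\<in>A. u i))\<close> is \<open>g x\<close> plus the sum of the directions
  \<open>\<Delta>(g; x; u\<^sub>T)\<close> over the nonempty \<open>T \<subseteq> A\<close>.  Newton's formula for \<open>f\<close> with these directions then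
  writes \<open>f (g (x + (\<Sum>i\<in>A. u i)))\<close> as a sum over all sets \<open>H\<close> of nonempty subsets of \<open>A\<close>.  Every such
  \<open>H\<close> covers exactly one \<open>B \<subseteq> A\<close>, namely \<open>\<Union>H\<close>, so collecting the terms by their union gives the
  required subset sum.
\<close>

lemma sum_Pow_insert:
  fixes F :: "'i set \<Rightarrow> 'b::comm_monoid_add"
  assumes "finite I" and "j \<notin> I"
  shows "sum F (Pow (insert j I)) = (\<Sum>S\<in>Pow I. F S) + (\<Sum>S\<in>Pow I. F (insert j S))"
proof -
  have "inj_on (insert j) (Pow I)"
    using assms(2) by (auto simp: inj_on_def)
  moreover have "Pow I \<inter> insert j ` Pow I = {}"
    using assms(2) by auto
  ultimately show ?thesis
    using assms(1) by (simp add: Pow_insert sum.union_disjoint sum.reindex)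
qed

lemma iterated_diff_empty: "iterated_diff h a {} w = h a"
  by (simp add: iterated_diff_def)

text \<open>
  The subsets of \<open>insert j I\<close> that contain \<open>j\<close> keep their sign and shift the base point by \<open>w j\<close>;
  the others change sign, because the index set has grown by one.
\<close>

lemma iterated_diff_insert:
  assumes "finite I" and "j \<notin> I"
  shows "iterated_diff h a (insert j I) w = iterated_diff h (a + w j) I w - iterated_diff h a I w"
proof -
  let ?t = "\<lambda>b I S. if even (card I - card S) then h (b + sum w S) else - h (b + sum w S)"
  have "?t a (insert j I) S = - ?t a I S" if "S \<in> Pow I" for S
  proof -
    have "card S \<le> card I"
      using that assms(1) by (simp add: card_mono)
    then show ?thesis
      using assms by (simp add: Suc_diff_le)
  qed
  moreover have "?t a (insert j I) (insert j S) = ?t (a + w j) I S" if "S \<in> Pow I" for S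
  proof -
    have "finite S" "j \<notin> S"
      using that assms by (auto intro: finite_subset)
    then show ?thesis
      using assms by (simp add: add.assoc)
  qed
  ultimately have "iterated_diff h a (insert j I) w
      = (\<Sum>S\<in>Pow I. - ?t a I S) + (\<Sum>S\<in>Pow I. ?t (a + w j) I S)"
    unfolding iterated_diff_def sum_Pow_insert[OF assms]
    by (intro arg_cong2[where f = "(+)"] sum.cong refl)
  then show ?thesis
    unfolding iterated_diff_def sum_negf by simp
qed

text \<open>
  Newton's formula.  In the induction step, the subsets with and without the new index \<open>j\<close>
  telescope, leaving the formula for the remaining indices at the base point \<open>a + w j\<close>.
\<close>

lemma sum_iterated_diff_subsets:
  assumes "finite J"
  shows "(\<Sum>I\<in>Pow J. iterated_diff h a I w) = h (a + (\<Sum>j\<in>J. w j))"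
  using assms
proof (induction J arbitrary: a rule: finite_induct)
  case empty
  then show ?case
    by (simp add: iterated_diff_empty)
next
  case (insert j J)
  have "iterated_diff h a (insert j I) w = iterated_diff h (a + w j) I w - iterated_diff h a I w"
    if "I \<in> Pow J" for I
    using that insert.hyps by (intro iterated_diff_insert) (auto intro: finite_subset)
  then have "(\<Sum>I\<in>Pow J. iterated_diff h a (insert j I) w)
      = (\<Sum>I\<in>Pow J. iterated_diff h (a + w j) I w - iterated_diff h a I w)"
    by (intro sum.cong refl)
  then have "(\<Sum>I\<in>Pow (insert j J). iterated_diff h a I w)
      = (\<Sum>I\<in>Pow J. iterated_diff h (a + w j) I w)"
    by (simp add: sum_Pow_insert[OF insert.hyps] sum_subtractf)
  also have "\<dots> = h (a + (\<Sum>j\<in>insert j J. w j))"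
    using insert by (simp add: add.assoc)
  finally show ?case .
qed

text \<open>
  This is the uniqueness half of Moebius inversion on finite subsets: the equation for \<open>A\<close>,
  less the terms for proper subsets, isolates the value at \<open>A\<close>.
\<close>

lemma subset_sums_determine:
  fixes P Q :: "'i set \<Rightarrow> 'b::ab_group_add"
  assumes eq: "\<And>A. finite A \<Longrightarrow> sum P (Pow A) = sum Q (Pow A)"
    and "finite A"
  shows "P A = Q A"
  using \<open>finite A\<close>
proof (induction A rule: finite_psubset_induct)
  case (psubset A)
  have "sum P (Pow A - {A}) = sum Q (Pow A - {A})"
    by (rule sum.cong) (auto intro!: psubset.IH)
  moreover have "sum R (Pow A) = R A + sum R (Pow A - {A})" for R :: "'i set \<Rightarrow> 'b"
    using psubset.hyps by (simp add: sum.remove)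
  ultimately show ?case
    using eq[OF psubset.hyps] by simp
qed

text \<open>
  The index set is arbitrary here because the inversion compares all subsets of \<open>{1..k}\<close>.  For
  \<open>A = {}\<close> the empty family \<open>H\<close> has to be admitted; it supplies the single term \<open>f (g x)\<close>.
\<close>

lemma iterated_diff_comp:
  fixes g :: "'x::ab_group_add \<Rightarrow> 'y::ab_group_add"
    and f :: "'y \<Rightarrow> 'z::ab_group_add"
    and u :: "'i \<Rightarrow> 'x"
  assumes "finite A"
  shows "iterated_diff (f \<circ> g) x A u =
         (\<Sum>H | {} \<notin> H \<and> \<Union>H = A. iterated_diff f (g x) H (\<lambda>T. iterated_diff g x T u))"
proof (rule subset_sums_determine[OF _ assms])
  fix A :: "'i set"
  assume fin: "finite A"
  let ?d = "\<lambda>T. iterated_diff g x T u"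
  let ?E = "\<lambda>H. iterated_diff f (g x) H ?d"
  let ?N = "Pow A - {{}}"
  have "(\<Sum>B\<in>Pow A. iterated_diff (f \<circ> g) x B u) = f (g (x + sum u A))"
    using fin by (simp add: sum_iterated_diff_subsets)
  also have "g (x + sum u A) = (\<Sum>T\<in>Pow A. ?d T)"
    using fin by (simp add: sum_iterated_diff_subsets)
  also have "\<dots> = g x + (\<Sum>T\<in>?N. ?d T)"
    using fin by (simp add: sum.remove[of _ "{}"] iterated_diff_empty)
  also have "f \<dots> = (\<Sum>H\<in>Pow ?N. ?E H)"
    using fin by (simp add: sum_iterated_diff_subsets)
  also have "\<dots> = (\<Sum>B\<in>Pow A. \<Sum>H | H \<in> Pow ?N \<and> \<Union>H = B. ?E H)"
    using fin by (intro sum.group[symmetric]) auto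
  also have "\<dots> = (\<Sum>B\<in>Pow A. \<Sum>H | {} \<notin> H \<and> \<Union>H = B. ?E H)"
    by (intro sum.cong) auto
  finally show "(\<Sum>B\<in>Pow A. iterated_diff (f \<circ> g) x B u)
      = (\<Sum>B\<in>Pow A. \<Sum>H | {} \<notin> H \<and> \<Union>H = B. ?E H)" .
qed

theorem theorem2:
  fixes g :: "'x::ab_group_add \<Rightarrow> 'y::ab_group_add"
    and f :: "'y \<Rightarrow> 'z::ab_group_add"
    and k :: nat and x :: 'x and u :: "nat \<Rightarrow> 'x"
  assumes "k \<ge> 1"
  shows "iterated_diff (f \<circ> g) x {1..k} u =
         (\<Sum>H\<in>coverings k. iterated_diff f (g x) H (\<lambda>T. iterated_diff g x T u))"
proof -
  have "coverings k = {H. {} \<notin> H \<and> \<Union>H = {1..k}}"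
    using assms by (auto simp: coverings_def)
  then show ?thesis
    by (simp add: iterated_diff_comp)
qed

end
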